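(* Let $q,z\in\mathbb{C}$ with $0<|q|<1$ and $z\ne0$. Then $$\sum_{n=0}^\infty\frac{(-1/z;q^2)_{n+1}(-zq^2;q^2)_n}{(-q)_{2n+1}}q^n=\sum_{n=0}^\infty q^{n(n+3)/2}\sum_{j=-\lfloor n/2\rfloor-1}^{\lfloor n/2\rfloor}z^jq^{-j(j+1)}.$$
   Context: $(a;p)_n=\prod_{j=1}^{n}(1-ap^{j-1})$ for $n\ge0$ (with $(a;p)_0=1$); when the base is omitted it is $q$: $(a)_n=(a;q)_n$. *)

theory Defs
  imports Complex_Main
begin

text \<open>The finite $q$-shifted factorial $(a;p)_n$.\<close>

definition qpoch :: "complex \<Rightarrow> complex \<Rightarrow> nat \<Rightarrow> complex" where
  "qpoch a p n = (\<Prod>j=1..n. 1 - a * p ^ (j - 1))"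

end

theory Submission imports Defs "HOL-Analysis.Infinite_Products" "HOL-Analysis.Infinite_Sum" begin

text \<open>
  By the finite Jacobi triple product, $(-1/z;q^2)_{n+1}(-zq^2;q^2)_n$ is a Laurent polynomial in
  $z$ whose coefficients are symmetric under $j \mapsto -1-j$. After interchanging the
  summations it remains to show, for $j \ge 0$ and
  $A_j = \sum_{n \ge j} q^n (q)_{2n+1} / ((q^2;q^2)_{n-j} (q^2;q^2)_{n+j+1})$, that
  $q^{2j(j+1)} A_j = \sum_{n \ge 2j} q^{n(n+3)/2}$.
  Both sides tend to $0$ as $j \to \infty$, so it suffices to compare differences, that is, to show
  $A_j - q^{4j+4} A_{j+1} = q^j (1 + q^{2j+2})$. The left-hand side is a multiple of the
  $q$-Gauss series ${}_2\phi_1(a, aq; a^2q^2; q^2, q)$ with $a = q^{2j+2}$. For $a = q^N$ this series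
  has the sum $(-q)_N$, which is proved by induction on $N$ with a telescoping
  certificate for its partial sums.
\<close>

section \<open>Elementary facts and uniform bounds for $(q;q)_n$\<close>

lemma qpoch_0 [simp]: "qpoch a p 0 = 1"
  by (simp add: qpoch_def)

lemma qpoch_Suc: "qpoch a p (Suc n) = qpoch a p n * (1 - a * p ^ n)"
  by (simp add: qpoch_def mult.commute)

lemma qpoch_self_Suc: "qpoch q q (Suc n) = qpoch q q n * (1 - q ^ Suc n)"
  by (simp add: qpoch_Suc)

lemma power_neq_1: 
  fixes q :: complex
  assumes "norm q < 1" "n > 0"
  shows "q ^ n \<noteq> 1"
proof
  assume "q ^ n = 1"
  hence "norm q ^ n = 1" by (metis norm_one norm_power)
  thus False using assms power_less_one_iff[of "norm q" n] by simp
qed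

lemma qpoch_self_nonzero: 
  assumes "norm q < 1"
  shows "qpoch q q n \<noteq> 0"
  by (induction n) (use power_neq_1[OF assms] in \<open>auto simp: qpoch_self_Suc simp del: power_Suc\<close>)

text \<open>Factor by factor, $1-q^{2k} = (1-q^k)(1+q^k)$. This later trades the denominator
  $(-q)_{2n+1}$ for $(q)_{2n+1}/(q^2;q^2)_{2n+1}$.\<close>

lemma qpoch_square_base: "qpoch (q\<^sup>2) (q\<^sup>2) n = qpoch q q n * qpoch (- q) q n"
proof (induction n)
  case (Suc n)
  have "1 - (q\<^sup>2) ^ Suc n = (1 - q ^ Suc n) * (1 + q ^ Suc n)"
    by (simp add: algebra_simps power_mult [symmetric] mult_2_right power_add power2_eq_square power_mult_distrib)
  then show ?case using Suc by (simp add: qpoch_Suc algebra_simps)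
qed simp

lemma norm_power2_less_1: "norm (q::complex) < 1 \<Longrightarrow> norm (q\<^sup>2) < 1"
  by (simp add: norm_power power_less_one_iff)

lemma qpoch_self_bounded:
  assumes "norm q < 1"
  obtains C where "C > 0" "\<And>n. norm (qpoch q q n) \<le> C" "\<And>n. norm (inverse (qpoch q q n)) \<le> C"
proof -
  define f where "f = (\<lambda>n. 1 - q ^ Suc n)"
  have "summable (\<lambda>n. norm (f n - 1))"
    using assms by (simp add: f_def norm_mult norm_power summable_mult summable_geometric)
  hence conv: "convergent_prod f"
    by (intro abs_convergent_prod_imp_convergent_prod summable_imp_abs_convergent_prod)
  have lim: "(\<lambda>n. \<Prod>i\<le>n. f i) \<longlonglongrightarrow> prodinf f"
    using conv by (rule convergent_prod_LIMSEQ)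
  have nz: "prodinf f \<noteq> 0"
    using power_neq_1[OF assms, of "Suc n" for n]
    by (intro prodinf_nonzero conv) (simp add: f_def del: power_Suc)
  have eq: "(\<Prod>i\<le>n. f i) = qpoch q q (Suc n)" for n
    by (induction n) (simp_all add: f_def qpoch_self_Suc)
  have lim1: "(\<lambda>n. qpoch q q n) \<longlonglongrightarrow> prodinf f"
    using lim unfolding eq by (simp add: filterlim_sequentially_Suc)
  have lim2: "(\<lambda>n. inverse (qpoch q q n)) \<longlonglongrightarrow> inverse (prodinf f)"
    by (intro tendsto_inverse lim1 nz)
  obtain A where A: "A > 0" "\<And>n. norm (qpoch q q n) \<le> A"
    using convergent_imp_Bseq[OF convergentI[OF lim1]] by (auto elim: BseqE)
  obtain B where B: "B > 0" "\<And>n. norm (inverse (qpoch q q n)) \<le> B"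
    using convergent_imp_Bseq[OF convergentI[OF lim2]] by (auto elim: BseqE)
  show ?thesis
    using A B by (intro that[of "max A B"]) (auto simp: less_max_iff_disj le_max_iff_disj)
qed

section \<open>Interchange of double series\<close>

text \<open>A product of two summable nonnegative sequences is a summable majorant on the grid of
  pairs, so Fubini for \<open>infsum\<close> applies. Rows, columns and their sums are then
  absolutely or unconditionally summable, where \<open>infsum\<close> and \<open>suminf\<close>
  agree.\<close>

lemma suminf_swap_dominated:
  fixes f :: "nat \<Rightarrow> nat \<Rightarrow> 'a :: banach" and x y :: "nat \<Rightarrow> real"
  assumes bound: "\<And>n j. norm (f n j) \<le> x n * y j"
    and x: "summable x" "\<And>n. x n \<ge> 0" and y: "summable y" "\<And>j. y j \<ge> 0"
  shows "summable (\<lambda>n. \<Sum>j. f n j)" "(\<Sum>n. \<Sum>j. f n j) = (\<Sum>j. \<Sum>n. f n j)"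
proof -
  have infsum_nat: "infsum g UNIV = suminf g" if "g summable_on UNIV" for g :: "nat \<Rightarrow> 'a"
    using has_sum_imp_sums[OF has_sum_infsum[OF that]] by (simp add: sums_iff)
  have xs: "x summable_on UNIV" and ys: "y summable_on UNIV"
    using x y summable_on_UNIV_nonneg_real_iff by blast+
  have "(\<lambda>(n, j). x n * y j) abs_summable_on UNIV \<times> UNIV"
    unfolding abs_summable_on_Sigma_iff
    using xs ys x y by (auto simp: abs_mult infsum_cmult_right' infsum_nonneg
        intro!: summable_on_cmult_right summable_on_cmult_left)
  hence "(\<lambda>(n, j). f n j) abs_summable_on UNIV \<times> UNIV"
    by (rule Infinite_Sum.abs_summable_on_comparison_test)
      (use bound x y in \<open>auto simp: abs_mult\<close>)
  hence S: "(\<lambda>(n, j). f n j) summable_on UNIV \<times> UNIV"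
    by (rule abs_summable_summable)
  hence S': "(\<lambda>(j, n). f n j) summable_on UNIV \<times> UNIV"
    by (subst (asm) summable_on_swap) simp
  have 1: "f n summable_on UNIV" for n
    by (rule abs_summable_summable, rule abs_summable_on_comparison_test'[OF _ bound])
      (intro summable_on_cmult_right ys)
  have 2: "(\<lambda>n. f n j) summable_on UNIV" for j
    by (rule abs_summable_summable, rule abs_summable_on_comparison_test'[OF _ bound])
      (intro summable_on_cmult_left xs)
  have 3: "(\<lambda>n. infsum (f n) UNIV) summable_on UNIV"
    using summable_on_Sigma_banach[OF S] by simp
  have 4: "(\<lambda>j. infsum (\<lambda>n. f n j) UNIV) summable_on UNIV"
    using summable_on_Sigma_banach[OF S'] by simp
  show "summable (\<lambda>n. \<Sum>j. f n j)"
    using summable_on_imp_summable[OF 3] by (simp add: infsum_nat 1)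
  show "(\<Sum>n. \<Sum>j. f n j) = (\<Sum>j. \<Sum>n. f n j)"
    using infsum_swap_banach[OF S] 3 4 by (simp add: infsum_nat 1 2)
qed

section \<open>The finite Jacobi triple product\<close>

text \<open>Extending $1/(p;p)_k$ by zero to $k < 0$ makes the recurrence
  $1/(p;p)_{k-1} = (1-p^k)/(p;p)_k$ hold for every integer $k$.\<close>

definition inv_qfac :: "complex \<Rightarrow> int \<Rightarrow> complex" where
  "inv_qfac p k = (if k < 0 then 0 else inverse (qpoch p p (nat k)))"

lemma inv_qfac_diff_1:
  assumes "norm p < 1"
  shows "inv_qfac p (k - 1) = (1 - p powi k) * inv_qfac p k"
proof (cases "k > 0")
  case True
  then obtain n where n: "k = int (Suc n)" by (metis gr0_implies_Suc zero_less_imp_eq_int)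
  have "1 - p ^ Suc n \<noteq> 0" using power_neq_1[OF assms, of "Suc n"] by simp
  hence "inverse (qpoch p p n) = (1 - p ^ Suc n) * inverse (qpoch p p (Suc n))"
    using qpoch_self_nonzero[OF assms, of n] by (simp add: qpoch_self_Suc field_simps del: power_Suc)
  moreover have "p powi k = p ^ Suc n" unfolding n power_int_of_nat ..
  ultimately show ?thesis unfolding n by (simp add: inv_qfac_def nat_add_distrib del: power_Suc)
\<comment> \<open>At $k=0$ the factor \<open>1 - p powi k\<close> vanishes; for $k<0$ both values of
  \<open>inv_qfac\<close> are zero.\<close>
qed (auto simp: inv_qfac_def)

text \<open>The coefficient of $z^j$ in $(-1/z;q^2)_{n+1}(-zq^2;q^2)_n$.\<close>

definition jtp_coeff :: "complex \<Rightarrow> nat \<Rightarrow> int \<Rightarrow> complex" where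
  "jtp_coeff q n j = q powi (j * (j + 1)) * qpoch (q\<^sup>2) (q\<^sup>2) (2 * n + 1) *
     inv_qfac (q\<^sup>2) (int n - j) * inv_qfac (q\<^sup>2) (int n + 1 + j)"

lemma jtp_coeff_eq_0: "j < - int n - 1 \<or> j > int n \<Longrightarrow> jtp_coeff q n j = 0"
  by (auto simp: jtp_coeff_def inv_qfac_def)

text \<open>This is the effect on the coefficients of multiplying by $(1+q^{2n+2}/z)(1+zq^{2n+2})$,
  the factor that leads from $n$ to $n+1$. All four coefficients are multiples of one common
  quantity, and dividing by it leaves a polynomial identity in $X$, $Y$ and $u$.\<close>

lemma jtp_coeff_Suc:
  assumes "q \<noteq> 0" "norm q < 1"
  shows "jtp_coeff q (Suc n) j = (1 + (q\<^sup>2) ^ (2 * n + 2)) * jtp_coeff q n j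
           + (q\<^sup>2) ^ (n + 1) * (jtp_coeff q n (j - 1) + jtp_coeff q n (j + 1))"
proof -
  define p where "p = q\<^sup>2"
  have p: "norm p < 1" "p \<noteq> 0" using assms by (simp_all add: p_def norm_power2_less_1)
  define X Y where "X = p powi (int n + 1 - j)" and "Y = p powi (int n + 2 + j)"
  define u where "u = inverse p"
  \<comment> \<open>These are the largest arguments, those of \<open>jtp_coeff q (Suc n) j\<close>.
    Every other value follows by stepping down with \<open>inv_qfac_diff_1\<close>, which only
    produces factors and never divides.\<close>
  define r s where "r = inv_qfac p (int n + 1 - j)" and "s = inv_qfac p (int n + 2 + j)"
  define t where "t = q powi (j * (j + 1))"
  have Xp: "p powi (int n - j) = X * u" and Yp: "p powi (int n + 1 + j) = Y * u"
    using p(2) power_int_diff[of p "int n + 1 - j" 1] power_int_diff[of p "int n + 2 + j" 1]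
    by (simp_all add: X_def Y_def u_def divide_inverse algebra_simps)
  have r1: "inv_qfac p (int n - j) = (1 - X) * r"
    using inv_qfac_diff_1[OF p(1), of "int n + 1 - j"]
    unfolding X_def r_def by (simp add: add.commute diff_diff_eq)
  have r2: "inv_qfac p (int n - (j + 1)) = (1 - X * u) * (1 - X) * r"
    using inv_qfac_diff_1[OF p(1), of "int n - j"] by (simp add: r1 Xp diff_diff_eq)
  have s1: "inv_qfac p (int n + 1 + j) = (1 - Y) * s"
  proof -
    have "int n + 1 + j = (int n + 2 + j) - 1" by simp
    thus ?thesis unfolding Y_def s_def by (simp only: inv_qfac_diff_1[OF p(1)])
  qed
  have s2: "inv_qfac p (int n + 1 + (j - 1)) = (1 - Y * u) * (1 - Y) * s"
    using inv_qfac_diff_1[OF p(1), of "int n + 1 + j"] by (simp add: s1 Yp)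
  have XY: "X * Y = p ^ (2 * n + 3)"
    using p(2) by (simp add: X_def Y_def power_int_add [symmetric] flip: power_int_of_nat)
  have XYp: "X * Y * u = p ^ (2 * n + 2)"
    using p(2) by (simp add: XY u_def eval_nat_numeral)
  have pq: "p powi k = q powi (2 * k)" for k
    by (simp add: p_def power_int_mult)
  \<comment> \<open>Replacing $j$ by $j-1$ changes $j(j+1)$ by $-2j$, and $p^{n+1}q^{-2j} =
    p^{n+1-j} = X$. The shift to $j+1$ gives $Y$ in the same way.\<close>
  have tX: "p ^ (n + 1) * q powi ((j - 1) * (j - 1 + 1)) = t * X"
    using assms by (simp add: t_def X_def pq flip: power_int_of_nat power_int_add) (simp add: algebra_simps)
  have tY: "p ^ (n + 1) * q powi ((j + 1) * (j + 1 + 1)) = t * Y"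
    using assms by (simp add: t_def Y_def pq flip: power_int_of_nat power_int_add) (simp add: algebra_simps)
  define Q where "Q = qpoch p p (2 * n + 1)"
  have Q: "qpoch p p (2 * Suc n + 1) = Q * (1 - X * Y * u) * (1 - X * Y)"
    unfolding XYp unfolding XY by (simp add: Q_def qpoch_Suc eval_nat_numeral)
  have r0: "inv_qfac p (int n - (j - 1)) = r" and s0: "inv_qfac p (int n + 1 + (j + 1)) = s"
    by (simp_all add: r_def s_def algebra_simps)
  have c0: "jtp_coeff q n j = t * Q * ((1 - X) * r) * ((1 - Y) * s)"
    unfolding jtp_coeff_def p_def [symmetric] r1 s1 t_def Q_def ..
  have c1: "p ^ (n + 1) * jtp_coeff q n (j - 1) = (t * X) * Q * r * ((1 - Y * u) * (1 - Y) * s)"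
    unfolding jtp_coeff_def p_def [symmetric] r0 s2 tX [symmetric] Q_def by (simp only: mult_ac)
  have c2: "p ^ (n + 1) * jtp_coeff q n (j + 1) = (t * Y) * Q * ((1 - X * u) * (1 - X) * r) * s"
    unfolding jtp_coeff_def p_def [symmetric] r2 s0 tY [symmetric] Q_def by (simp only: mult_ac)
  have "jtp_coeff q (Suc n) j = t * Q * (1 - X * Y * u) * (1 - X * Y) * r * s"
    unfolding jtp_coeff_def p_def [symmetric] Q t_def r_def s_def
    by (simp add: algebra_simps)
  also have "\<dots> = t * Q * r * s * ((1 + X * Y * u) * (1 - X) * (1 - Y)
       + X * (1 - Y * u) * (1 - Y) + Y * (1 - X * u) * (1 - X))"
    by (simp add: algebra_simps)
  also have "\<dots> = (1 + X * Y * u) * (t * Q * ((1 - X) * r) * ((1 - Y) * s))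
       + ((t * X) * Q * r * ((1 - Y * u) * (1 - Y) * s) + (t * Y) * Q * ((1 - X * u) * (1 - X) * r) * s)"
    by (simp add: algebra_simps)
  also have "\<dots> = (1 + p ^ (2 * n + 2)) * jtp_coeff q n j
           + p ^ (n + 1) * (jtp_coeff q n (j - 1) + jtp_coeff q n (j + 1))"
    unfolding c0 XYp distrib_left[of "p ^ (n + 1)"] c1 c2 ..
  finally show ?thesis unfolding p_def .
qed

text \<open>Induction on $n$: the two new factors multiply to $1+p^{2n+2}+p^{n+1}(z+1/z)$ with
  $p=q^2$, and \<open>jtp_coeff_Suc\<close> is the matching recurrence.\<close>

lemma finite_jacobi_triple_product:
  assumes "q \<noteq> 0" "norm q < 1" "z \<noteq> 0"
  shows "qpoch (- 1 / z) (q\<^sup>2) (n + 1) * qpoch (- z * q\<^sup>2) (q\<^sup>2) n =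
           (\<Sum>j = - int n - 1..int n. z powi j * jtp_coeff q n j)"
proof (induction n)
  case 0
  have "{- 1..0::int} = {- 1, 0}" by auto
  moreover have "1 - q\<^sup>2 \<noteq> 0"
    using power_neq_1[OF assms(2), of 2] by simp
  ultimately show ?case using assms
    by (simp add: qpoch_def jtp_coeff_def inv_qfac_def power_int_minus field_simps)
next
  case (Suc n)
  define p where "p = q\<^sup>2"
  define c where "c = jtp_coeff q n"
  define I where "I = {- int n - 1..int n}"
  define J where "J = {- int (Suc n) - 1..int (Suc n)}"
  \<comment> \<open>Coefficients outside $I$ vanish, so the sum and its two shifts, by $z$ and by
    $1/z$, can all be written over the larger range $J$ and compared termwise.\<close>
  have IJ: "(\<Sum>j\<in>I. z powi j * c j) = (\<Sum>j\<in>J. z powi j * c j)"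
    by (intro sum.mono_neutral_left) (auto simp: I_def J_def c_def jtp_coeff_eq_0)
  have up: "z * (\<Sum>j\<in>I. z powi j * c j) = (\<Sum>j\<in>J. z powi j * c (j - 1))"
  proof -
    have "z * (\<Sum>j\<in>I. z powi j * c j) = (\<Sum>j\<in>I. z powi (j + 1) * c j)"
      using assms by (simp add: sum_distrib_left power_int_add_1 mult_ac)
    also have "\<dots> = (\<Sum>j\<in>{- int n..int n + 1}. z powi j * c (j - 1))"
      by (rule sum.reindex_bij_witness[of _ "\<lambda>j. j - 1" "\<lambda>j. j + 1"]) (auto simp: I_def)
    also have "\<dots> = (\<Sum>j\<in>J. z powi j * c (j - 1))"
      by (intro sum.mono_neutral_left) (auto simp: J_def c_def jtp_coeff_eq_0)
    finally show ?thesis .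
  qed
  have down: "(\<Sum>j\<in>I. z powi j * c j) / z = (\<Sum>j\<in>J. z powi j * c (j + 1))"
  proof -
    have "(\<Sum>j\<in>I. z powi j * c j) / z = (\<Sum>j\<in>I. z powi (j - 1) * c j)"
      using assms by (simp add: sum_divide_distrib power_int_diff)
    also have "\<dots> = (\<Sum>j\<in>{- int n - 2..int n - 1}. z powi j * c (j + 1))"
      by (rule sum.reindex_bij_witness[of _ "\<lambda>j. j + 1" "\<lambda>j. j - 1"]) (auto simp: I_def)
    also have "\<dots> = (\<Sum>j\<in>J. z powi j * c (j + 1))"
      by (intro sum.mono_neutral_left) (auto simp: J_def c_def jtp_coeff_eq_0)
    finally show ?thesis .
  qed
  have "qpoch (- 1 / z) p (Suc n + 1) * qpoch (- z * p) p (Suc n)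
      = (qpoch (- 1 / z) p (n + 1) * qpoch (- z * p) p n) * ((1 + p ^ (n + 1) / z) * (1 + z * p ^ (n + 1)))"
    by (simp add: qpoch_Suc mult_ac)
  also have "\<dots> = (\<Sum>j\<in>I. z powi j * c j) * ((1 + p ^ (n + 1) / z) * (1 + z * p ^ (n + 1)))"
    using Suc by (simp only: p_def c_def I_def)
  also have "(1 + p ^ (n + 1) / z) * (1 + z * p ^ (n + 1))
      = (1 + p ^ (2 * n + 2)) + p ^ (n + 1) * (z + 1 / z)"
    using assms by (simp add: field_simps power_add mult_2_right power2_eq_square)
  also have "(\<Sum>j\<in>I. z powi j * c j) * \<dots> = (1 + p ^ (2 * n + 2)) * (\<Sum>j\<in>I. z powi j * c j)
      + p ^ (n + 1) * (z * (\<Sum>j\<in>I. z powi j * c j) + (\<Sum>j\<in>I. z powi j * c j) / z)"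
    by (simp add: algebra_simps)
  also have "\<dots> = (\<Sum>j\<in>J. z powi j * ((1 + p ^ (2 * n + 2)) * c j + p ^ (n + 1) * (c (j - 1) + c (j + 1))))"
    unfolding up down unfolding IJ by (simp add: sum_distrib_left sum.distrib algebra_simps)
  also have "\<dots> = (\<Sum>j\<in>J. z powi j * jtp_coeff q (Suc n) j)"
    unfolding jtp_coeff_Suc[OF assms(1,2)] p_def c_def ..
  finally show ?case unfolding J_def p_def .
qed

lemma sum_int_symmetric_fold:
  fixes h :: "int \<Rightarrow> 'a :: comm_monoid_add"
  shows "(\<Sum>j = - int n - 1..int n. h j) = (\<Sum>j\<le>n. h (int j) + h (- 1 - int j))"
proof (induction n)
  case 0
  have "{- 1..0::int} = {- 1, 0}" by auto
  then show ?case by (simp add: add.commute)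
next
  case (Suc n)
  have "{- int (Suc n) - 1..int (Suc n)} = insert (int (Suc n)) (insert (- 1 - int (Suc n)) {- int n - 1..int n})"
    by auto
  then show ?case using Suc by (simp add: algebra_simps)
qed

section \<open>The $q$-Gauss series\<close>

text \<open>Up to the factor $(-q)_{M+1}$, these are the summands of the $q$-Gauss series
  ${}_2\phi_1(a, aq; a^2q^2; q^2, q)$ with $a = q^{M+1}$.\<close>

definition gauss_term :: "complex \<Rightarrow> nat \<Rightarrow> nat \<Rightarrow> complex" where
  "gauss_term q M m = q ^ m * (1 - q ^ (M + 1)) * qpoch q q (M + 2 * m) /
     (qpoch (q\<^sup>2) (q\<^sup>2) m * qpoch (q\<^sup>2) (q\<^sup>2) (m + M + 1))"

text \<open>The remainder after $k$ terms has a closed form; its induction step comes down to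
  $(1-q^{2k+4})-(1-q) = q(1-q^{2k+3})$.\<close>

lemma gauss_term_telescope_0:
  assumes "norm q < 1"
  shows "(\<Sum>m\<le>k. gauss_term q 0 m) = 1 - q ^ (k + 1) * qpoch q q (2 * k + 1) /
     (qpoch (q\<^sup>2) (q\<^sup>2) k * qpoch (q\<^sup>2) (q\<^sup>2) (k + 1))"
proof (induction k)
  case 0
  have "1 - q\<^sup>2 \<noteq> 0" using power_neq_1[OF assms, of 2] by simp
  then show ?case
    by (simp add: gauss_term_def qpoch_Suc field_simps power2_eq_square)
next
  case (Suc k)
  define x where "x = q ^ k"
  define A where "A = qpoch q q (2 * k + 1)"
  define P where "P = qpoch (q\<^sup>2) (q\<^sup>2) k"
  have nz: "P \<noteq> 0" "1 - (q * x)\<^sup>2 \<noteq> 0" "1 - (q\<^sup>2 * x)\<^sup>2 \<noteq> 0"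
    using qpoch_self_nonzero[OF norm_power2_less_1[OF assms], of k]
      power_neq_1[OF assms, of "2 * (k + 1)"] power_neq_1[OF assms, of "2 * (k + 2)"]
    by (auto simp: P_def x_def power_mult_distrib power_add mult_ac power2_eq_square mult_2_right)
  have e: "qpoch (q\<^sup>2) (q\<^sup>2) (k + 1) = P * (1 - (q * x)\<^sup>2)"
    "qpoch (q\<^sup>2) (q\<^sup>2) (Suc k + 1) = P * (1 - (q * x)\<^sup>2) * (1 - (q\<^sup>2 * x)\<^sup>2)"
    "qpoch q q (0 + 2 * Suc k) = A * (1 - (q * x)\<^sup>2)"
    "qpoch q q (2 * Suc k + 1) = A * (1 - (q * x)\<^sup>2) * (1 - q * (q * x)\<^sup>2)"
    by (simp_all add: qpoch_Suc P_def A_def x_def power_mult_distrib mult_ac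
        power_add power2_eq_square mult_2_right)
  have e1: "qpoch (q\<^sup>2) (q\<^sup>2) (Suc k) = P * (1 - (q * x)\<^sup>2)"
    using e(1) by simp
  have g: "gauss_term q 0 (Suc k) = q * x * (1 - q) * (A * (1 - (q * x)\<^sup>2)) /
        ((P * (1 - (q * x)\<^sup>2)) * (P * (1 - (q * x)\<^sup>2) * (1 - (q\<^sup>2 * x)\<^sup>2)))"
    using e by (simp add: gauss_term_def x_def)
  have "(\<Sum>m\<le>Suc k. gauss_term q 0 m) = 1 - q * x * A / (P * (P * (1 - (q * x)\<^sup>2)))
      + q * x * (1 - q) * (A * (1 - (q * x)\<^sup>2)) /
        ((P * (1 - (q * x)\<^sup>2)) * (P * (1 - (q * x)\<^sup>2) * (1 - (q\<^sup>2 * x)\<^sup>2)))"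
    unfolding sum.atMost_Suc Suc g e by (simp add: x_def A_def P_def)
  also have "\<dots> = 1 - q * q * x * (A * (1 - (q * x)\<^sup>2) * (1 - q * (q * x)\<^sup>2)) /
        ((P * (1 - (q * x)\<^sup>2)) * (P * (1 - (q * x)\<^sup>2) * (1 - (q\<^sup>2 * x)\<^sup>2)))"
    using nz by (simp add: divide_simps) (simp add: algebra_simps power2_eq_square eval_nat_numeral)
  also have "\<dots> = 1 - q ^ (Suc k + 1) * qpoch q q (2 * Suc k + 1) /
        (qpoch (q\<^sup>2) (q\<^sup>2) (Suc k) * qpoch (q\<^sup>2) (q\<^sup>2) (Suc k + 1))"
    unfolding e e1 by (simp add: x_def)
  finally show ?case .
qed

text \<open>With this normalisation the sum should not depend on $M$. Accordingly the differences of
  the terms for $M+1$ and $M$ telescope, leaving one boundary term that tends to zero.\<close>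

lemma gauss_term_telescope_Suc:
  assumes "norm q < 1"
  shows "(\<Sum>m\<le>k. gauss_term q (Suc M) m) = (\<Sum>m\<le>k. gauss_term q M m)
     - q ^ (M + k + 2) * qpoch q q (M + 2 * k + 2) /
     (qpoch (q\<^sup>2) (q\<^sup>2) k * qpoch (q\<^sup>2) (q\<^sup>2) (k + M + 2))"
proof (induction k)
  case 0
  define A where "A = qpoch q q M"
  define P where "P = qpoch (q\<^sup>2) (q\<^sup>2) (M + 1)"
  define b where "b = q ^ (M + 2)"
  have nz: "P \<noteq> 0" "1 - b\<^sup>2 \<noteq> 0"
    using qpoch_self_nonzero[OF norm_power2_less_1[OF assms], of "M + 1"]
      power_neq_1[OF assms, of "2 * (M + 2)"]
    by (auto simp: P_def b_def power_add mult_ac power2_eq_square mult_2_right)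
  have e: "qpoch (q\<^sup>2) (q\<^sup>2) (M + 2) = P * (1 - b\<^sup>2)" "qpoch q q (Suc M) = A * (1 - q ^ (M + 1))"
    "qpoch q q (M + 2) = A * (1 - q ^ (M + 1)) * (1 - b)"
    by (simp_all add: qpoch_Suc P_def b_def A_def power_mult_distrib mult_ac
        power_add power2_eq_square mult_2_right)
  have "gauss_term q (Suc M) 0 = (1 - b) * (A * (1 - q ^ (M + 1))) / (P * (1 - b\<^sup>2))"
    unfolding e[symmetric] by (simp add: gauss_term_def b_def)
  also have "\<dots> = (1 - q ^ (M + 1)) * A / P - b * (A * (1 - q ^ (M + 1)) * (1 - b)) / (P * (1 - b\<^sup>2))"
    using nz by (simp add: divide_simps) (simp add: algebra_simps power2_eq_square)
  also have "\<dots> = gauss_term q M 0 - q ^ (M + 2) * qpoch q q (M + 2) / qpoch (q\<^sup>2) (q\<^sup>2) (M + 2)"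
    unfolding e by (simp add: gauss_term_def b_def A_def P_def)
  finally show ?case by simp
next
  case (Suc k)
  define x where "x = q ^ k"
  define a where "a = q ^ (M + 1)"
  define A where "A = qpoch q q (M + 2 * k + 2)"
  define P where "P = qpoch (q\<^sup>2) (q\<^sup>2) k"
  define R where "R = qpoch (q\<^sup>2) (q\<^sup>2) (k + M + 2)"
  have nz: "P \<noteq> 0" "R \<noteq> 0" "1 - (q * x)\<^sup>2 \<noteq> 0" "1 - (a * q\<^sup>2 * x)\<^sup>2 \<noteq> 0"
    using qpoch_self_nonzero[OF norm_power2_less_1[OF assms]]
      power_neq_1[OF assms, of "2 * (k + 1)"] power_neq_1[OF assms, of "2 * (M + k + 3)"]
    by (auto simp: P_def R_def x_def a_def power_mult_distrib power_add mult_ac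
        power2_eq_square eval_nat_numeral mult_2_right)
  have e: "qpoch (q\<^sup>2) (q\<^sup>2) (Suc k) = P * (1 - (q * x)\<^sup>2)"
    "qpoch (q\<^sup>2) (q\<^sup>2) (Suc k + M + 2) = R * (1 - (a * q\<^sup>2 * x)\<^sup>2)"
    "qpoch q q (Suc M + 2 * Suc k) = A * (1 - a * q\<^sup>2 * x\<^sup>2)"
    "qpoch q q (M + 2 * Suc k + 2) = A * (1 - a * q\<^sup>2 * x\<^sup>2) * (1 - a * q ^ 3 * x\<^sup>2)"
    by (simp_all add: qpoch_Suc P_def A_def R_def x_def a_def power_mult_distrib mult_ac
        power_add power2_eq_square mult_2_right eval_nat_numeral)
  have g1: "gauss_term q (Suc M) (Suc k) = q * x * (1 - a * q) * (A * (1 - a * q\<^sup>2 * x\<^sup>2)) /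
     ((P * (1 - (q * x)\<^sup>2)) * (R * (1 - (a * q\<^sup>2 * x)\<^sup>2)))"
    unfolding e[symmetric] gauss_term_def by (simp add: x_def a_def mult_ac)
  have g2: "gauss_term q M (Suc k) = q * x * (1 - a) * A / ((P * (1 - (q * x)\<^sup>2)) * R)"
    unfolding e[symmetric] gauss_term_def by (simp add: x_def a_def A_def R_def mult_ac)
  have "(\<Sum>m\<le>Suc k. gauss_term q (Suc M) m) - (\<Sum>m\<le>Suc k. gauss_term q M m)
      = - (a * q * x * A / (P * R)) + gauss_term q (Suc M) (Suc k) - gauss_term q M (Suc k)"
    using Suc by (simp add: x_def A_def P_def R_def a_def power_add power2_eq_square mult_ac)
  \<comment> \<open>Once the common factor $qxA$ and the denominators are cleared, this is a
    polynomial identity in $a$, $q$ and $x$.\<close>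
  also have "\<dots> = - (a * q\<^sup>2 * x * (A * (1 - a * q\<^sup>2 * x\<^sup>2) * (1 - a * q ^ 3 * x\<^sup>2)) /
        ((P * (1 - (q * x)\<^sup>2)) * (R * (1 - (a * q\<^sup>2 * x)\<^sup>2))))"
    unfolding g1 g2 using nz by (simp add: divide_simps) (simp add: algebra_simps power2_eq_square eval_nat_numeral)
  also have "\<dots> = - (q ^ (M + Suc k + 2) * qpoch q q (M + 2 * Suc k + 2) /
        (qpoch (q\<^sup>2) (q\<^sup>2) (Suc k) * qpoch (q\<^sup>2) (q\<^sup>2) (Suc k + M + 2)))"
    unfolding e by (simp add: x_def a_def power_add power2_eq_square mult_ac)
  finally show ?case by (simp add: algebra_simps)
qed

text \<open>Both telescoping remainders have this shape. The factorials and their inverses are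
  bounded uniformly in the index, so \<open>f\<close> and \<open>g\<close> may be arbitrary and
  $q^k$ forces the limit.\<close>

lemma gauss_tail_tendsto_0:
  assumes "norm q < 1"
  shows "(\<lambda>k. q ^ (c + k) * qpoch q q (f k) / (qpoch (q\<^sup>2) (q\<^sup>2) k * qpoch (q\<^sup>2) (q\<^sup>2) (g k))) \<longlonglongrightarrow> 0"
proof -
  obtain C where C: "C > 0" "\<And>n. norm (qpoch q q n) \<le> C"
    using qpoch_self_bounded[OF assms] by metis
  obtain D where D: "D > 0" "\<And>n. norm (inverse (qpoch (q\<^sup>2) (q\<^sup>2) n)) \<le> D"
    using qpoch_self_bounded[OF norm_power2_less_1[OF assms]] by metis
  show ?thesis
  proof (rule Lim_null_comparison)
    show "\<forall>\<^sub>F k in sequentially. norm (q ^ (c + k) * qpoch q q (f k) /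
        (qpoch (q\<^sup>2) (q\<^sup>2) k * qpoch (q\<^sup>2) (q\<^sup>2) (g k))) \<le> norm q ^ k * (C * (D * D))"
    proof (intro always_eventually allI)
      fix k
      have "norm q ^ (c + k) \<le> norm q ^ k"
        using assms by (intro power_decreasing) auto
      then have "norm q ^ (c + k) * (norm (qpoch q q (f k)) * (norm (inverse (qpoch (q\<^sup>2) (q\<^sup>2) k)) *
          norm (inverse (qpoch (q\<^sup>2) (q\<^sup>2) (g k))))) \<le> norm q ^ k * (C * (D * D))"
        using C D less_imp_le[OF C(1)] less_imp_le[OF D(1)] by (intro mult_mono) auto
      then show "norm (q ^ (c + k) * qpoch q q (f k) /
        (qpoch (q\<^sup>2) (q\<^sup>2) k * qpoch (q\<^sup>2) (q\<^sup>2) (g k))) \<le> norm q ^ k * (C * (D * D))"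
        by (simp add: divide_inverse norm_mult norm_power mult_ac)
    qed
    show "(\<lambda>k. norm q ^ k * (C * (D * D))) \<longlonglongrightarrow> 0"
      using assms by (intro tendsto_mult_left_zero LIMSEQ_power_zero) simp
  qed
qed

lemma gauss_term_sums:
  assumes "norm q < 1"
  shows "gauss_term q M sums 1"
  unfolding sums_def_le
proof (induction M)
  case 0
  show ?case unfolding gauss_term_telescope_0[OF assms]
    using tendsto_diff[OF tendsto_const[of 1] gauss_tail_tendsto_0[OF assms, of 1]]
    by (simp add: add.commute)
next
  case (Suc M)
  show ?case unfolding gauss_term_telescope_Suc[OF assms]
    using tendsto_diff[OF Suc gauss_tail_tendsto_0[OF assms, of "M + 2"]]
    by (simp add: add_ac)
qed

section \<open>The column sums $A_j$\<close>

text \<open>The summand of $A_j$, set to zero for $n<j$, where \<open>n - j\<close> would be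
  truncated. Up to a constant, its denominator is the kernel of Bailey's lemma with base $q^2$ and
  $a=q^2$.\<close>

definition bailey_term :: "complex \<Rightarrow> nat \<Rightarrow> nat \<Rightarrow> complex" where
  "bailey_term q n j = (if j \<le> n then q ^ n * qpoch q q (2 * n + 1) /
     (qpoch (q\<^sup>2) (q\<^sup>2) (n - j) * qpoch (q\<^sup>2) (q\<^sup>2) (n + j + 1)) else 0)"

lemma bailey_term_bounded:
  assumes "norm q < 1"
  obtains C where "C > 0" "\<And>n j. norm (bailey_term q n j) \<le> norm q ^ n * C"
proof -
  obtain C where C: "C > 0" "\<And>n. norm (qpoch q q n) \<le> C"
    using qpoch_self_bounded[OF assms] by metis
  obtain D where D: "D > 0" "\<And>n. norm (inverse (qpoch (q\<^sup>2) (q\<^sup>2) n)) \<le> D"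
    using qpoch_self_bounded[OF norm_power2_less_1[OF assms]] by metis
  have "norm (bailey_term q n j) \<le> norm q ^ n * (C * (D * D))" for n j
  proof (cases "j \<le> n")
    case True
    have "norm q ^ n * (norm (qpoch q q (2 * n + 1)) * (norm (inverse (qpoch (q\<^sup>2) (q\<^sup>2) (n - j))) *
        norm (inverse (qpoch (q\<^sup>2) (q\<^sup>2) (n + j + 1))))) \<le> norm q ^ n * (C * (D * D))"
      using C D less_imp_le[OF C(1)] less_imp_le[OF D(1)] by (intro mult_mono) auto
    then show ?thesis using True
      by (simp add: bailey_term_def divide_inverse norm_mult norm_power mult_ac)
  qed (use C D in \<open>simp add: bailey_term_def\<close>)
  then show ?thesis using C D by (intro that[of "C * (D * D)"]) auto
qed

lemma bailey_term_summable:
  assumes "norm q < 1"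
  shows "summable (\<lambda>n. bailey_term q n j)"
proof -
  obtain C where "C > 0" "\<And>n j. norm (bailey_term q n j) \<le> norm q ^ n * C"
    using bailey_term_bounded[OF assms] by metis
  moreover have "summable (\<lambda>n. norm q ^ n * C)"
    using assms by (intro summable_mult2 summable_geometric) simp
  ultimately show ?thesis
    by - (rule summable_comparison_test'[of "\<lambda>n. norm q ^ n * C" 0], auto)
qed

text \<open>With $b=q^{2j+2}$ and $Y=b^2q^{2m}$, the common denominator leaves $(1-Y)-b^2(1-q^{2m})
  = 1-b^2 = (1-b)(1+b)$. The factor $1-b$ belongs to the Gauss term with $M=2j+1$.\<close>

lemma bailey_term_diff:
  assumes "norm q < 1"
  shows "bailey_term q (m + j) j - q ^ (4 * (j + 1)) * bailey_term q (m + j) (j + 1) =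
           q ^ j * (1 + q ^ (2 * j + 2)) * gauss_term q (2 * j + 1) m"
proof -
  define p where "p = q\<^sup>2"
  define b where "b = q ^ (2 * j + 2)"
  define A where "A = q ^ (m + j) * qpoch q q (2 * (m + j) + 1)"
  define R where "R = qpoch p p (m + 2 * j + 1)"
  define Y where "Y = p ^ (m + 2 * j + 2)"
  have p: "norm p < 1" using assms by (simp add: p_def norm_power2_less_1)
  have nz: "qpoch p p m \<noteq> 0" "R \<noteq> 0" "1 - Y \<noteq> 0"
    using qpoch_self_nonzero[OF p] power_neq_1[OF p, of "m + 2 * j + 2"] by (auto simp: R_def Y_def)
  have b2: "q ^ (4 * (j + 1)) = b\<^sup>2"
  proof -
    have "4 * (j + 1) = (2 * j + 2) * 2" by simp
    then show ?thesis unfolding b_def power_mult [symmetric] by (rule arg_cong)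
  qed
  have R': "qpoch p p (m + 2 * j + 2) = R * (1 - Y)"
    by (simp add: R_def Y_def qpoch_Suc)
  have 1: "bailey_term q (m + j) j = A / (qpoch p p m * R)"
    by (simp add: bailey_term_def A_def R_def p_def mult_2 add_ac)
  have 2: "b\<^sup>2 * bailey_term q (m + j) (j + 1) = b\<^sup>2 * (1 - p ^ m) * A / (qpoch p p m * (R * (1 - Y)))"
  \<comment> \<open>For $m=0$ the term is zero by the cutoff $j+1>j$, in agreement with
    $1-p^0=0$.\<close>
  proof (cases m)
    case 0
    then show ?thesis by (simp add: bailey_term_def)
  next
    case (Suc m')
    have "qpoch p p m = qpoch p p m' * (1 - p ^ m)" by (simp add: Suc qpoch_Suc)
    moreover have "1 - p ^ m \<noteq> 0" using power_neq_1[OF p, of m] Suc by simp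
    moreover have "bailey_term q (m + j) (j + 1) = A / (qpoch p p m' * (R * (1 - Y)))"
      unfolding R'[symmetric] by (simp add: bailey_term_def A_def p_def mult_2 add_ac Suc)
    ultimately show ?thesis by simp
  qed
  have Y: "b\<^sup>2 * p ^ m = Y"
  proof -
    have "(2 * j + 2) * 2 + 2 * m = 2 * (m + 2 * j + 2)" by simp
    then show ?thesis
      unfolding b_def p_def Y_def power_mult [symmetric] power_add [symmetric] by (rule arg_cong)
  qed
  have 3: "q ^ j * gauss_term q (2 * j + 1) m = A * (1 - b) / (qpoch p p m * (R * (1 - Y)))"
    unfolding R'[symmetric] by (simp add: gauss_term_def A_def p_def b_def power_add algebra_simps)
  have "bailey_term q (m + j) j - b\<^sup>2 * bailey_term q (m + j) (j + 1)
      = (A * (1 - Y) - A * (b\<^sup>2 - b\<^sup>2 * p ^ m)) / (qpoch p p m * (R * (1 - Y)))"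
    unfolding 1 2 using nz by (simp add: divide_simps) (simp add: algebra_simps)
  also have "\<dots> = (1 + b) * (q ^ j * gauss_term q (2 * j + 1) m)"
    unfolding 3 Y by (simp add: algebra_simps power2_eq_square)
  finally show ?thesis unfolding b2 by (simp add: b_def mult_ac)
qed

lemma bailey_suminf_diff:
  assumes "norm q < 1"
  shows "(\<Sum>n. bailey_term q n j) - q ^ (4 * (j + 1)) * (\<Sum>n. bailey_term q n (j + 1)) =
           q ^ j * (1 + q ^ (2 * j + 2))"
proof -
  define f where "f = (\<lambda>n. bailey_term q n j - q ^ (4 * (j + 1)) * bailey_term q n (j + 1))"
  have "(\<lambda>m. f (m + j)) sums (q ^ j * (1 + q ^ (2 * j + 2)) * 1)"
    unfolding f_def bailey_term_diff[OF assms] by (intro sums_mult gauss_term_sums assms)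
  \<comment> \<open>Both terms are cut off for $n<j$, so the shift by $j$ loses nothing.\<close>
  moreover have "(\<Sum>n<j. f n) = 0"
    by (rule sum.neutral) (simp add: f_def bailey_term_def)
  ultimately have "f sums (q ^ j * (1 + q ^ (2 * j + 2)))"
    using sums_iff_shift[of f j "q ^ j * (1 + q ^ (2 * j + 2)) * 1"] by simp
  moreover have "f sums ((\<Sum>n. bailey_term q n j) - q ^ (4 * (j + 1)) * (\<Sum>n. bailey_term q n (j + 1)))"
    unfolding f_def by (intro sums_diff sums_mult summable_sums bailey_term_summable assms)
  ultimately show ?thesis by (rule sums_unique2 [symmetric])
qed

lemma triangular_power_summable:
  assumes "norm (q :: complex) < 1"
  shows "summable (\<lambda>n. q ^ (n * (n + 3) div 2))"
proof (rule summable_comparison_test'[of "\<lambda>n. norm q ^ n" 0])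
  fix n :: nat
  have "n * 2 \<le> n * (n + 3)" by (intro mult_le_mono2) simp
  then have "n \<le> n * (n + 3) div 2" by linarith
  then show "norm (q ^ (n * (n + 3) div 2)) \<le> norm q ^ n"
    using assms by (auto simp: norm_power intro!: power_decreasing)
qed (use assms in \<open>auto intro: summable_geometric\<close>)

text \<open>The difference \<open>d\<close> of the two sides is constant in $j$ by
  \<open>bailey_suminf_diff\<close> and tends to zero, so it vanishes.\<close>

lemma bailey_suminf:
  assumes "norm q < 1"
  shows "q ^ (2 * (j * (j + 1))) * (\<Sum>n. bailey_term q n j) =
           (\<Sum>n. q ^ ((n + 2 * j) * (n + 2 * j + 3) div 2))"
proof -
  define A where "A = (\<lambda>j. \<Sum>n. bailey_term q n j)"
  define r where "r = (\<lambda>n. q ^ (n * (n + 3) div 2))"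
  define S where "S = (\<lambda>k. suminf r - (\<Sum>i<k. r i))"
  define d where "d = (\<lambda>j. q ^ (2 * (j * (j + 1))) * A j - S (2 * j))"
  have r: "summable r"
    unfolding r_def by (rule triangular_power_summable[OF assms])
  have d_Suc: "d (Suc j) = d j" for j
  proof -
    have e: "2 * j * (2 * j + 3) div 2 = j * (2 * j + 3)"
      "Suc (2 * j) * (Suc (2 * j) + 3) div 2 = (2 * j + 1) * (j + 2)"
      by (simp_all add: algebra_simps)
    have "S (2 * j) - S (2 * Suc j) = r (2 * j) + r (Suc (2 * j))"
      by (simp add: S_def)
    also have "\<dots> = q ^ (2 * (j * (j + 1))) * (q ^ j * (1 + q ^ (2 * j + 2)))"
      unfolding r_def e by (simp add: algebra_simps flip: power_add)
    also have "\<dots> = q ^ (2 * (j * (j + 1))) * A j - q ^ (2 * (j * (j + 1))) * q ^ (4 * (j + 1)) * A (j + 1)"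
      unfolding A_def bailey_suminf_diff[OF assms, symmetric] by (simp add: algebra_simps)
    also have "q ^ (2 * (j * (j + 1))) * q ^ (4 * (j + 1)) = q ^ (2 * (Suc j * (Suc j + 1)))"
      unfolding power_add [symmetric] by (rule arg_cong[of _ _ "power q"]) simp
    finally show ?thesis by (simp add: d_def algebra_simps)
  qed
  have d_const: "d j = d 0" for j
    by (induction j) (simp_all add: d_Suc)
  have S_lim: "(\<lambda>k. S k) \<longlonglongrightarrow> 0"
    using tendsto_diff[OF tendsto_const[of "suminf r"] summable_LIMSEQ[OF r]] by (simp add: S_def)
  have "(\<lambda>j. S (2 * j)) \<longlonglongrightarrow> 0"
    using filterlim_compose[OF S_lim, of "\<lambda>j. 2 * j" sequentially]
    by (simp add: filterlim_subseq strict_mono_def)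
  moreover have "(\<lambda>j. q ^ (2 * (j * (j + 1))) * A j) \<longlonglongrightarrow> 0"
  proof -
    obtain C where C: "C > 0" "\<And>n j. norm (bailey_term q n j) \<le> norm q ^ n * C"
      using bailey_term_bounded[OF assms] by metis
    define B where "B = (\<Sum>n. norm q ^ n * C)"
    have sB: "summable (\<lambda>n. norm q ^ n * C)"
      using assms by (intro summable_mult2 summable_geometric) simp
    \<comment> \<open>The bound on $A_j$ does not depend on $j$, so the prefactor $q^{2j(j+1)}$
      alone drives the product to zero.\<close>
    have AB: "norm (A j) \<le> B" for j
      unfolding A_def B_def by (rule norm_suminf_le[OF _ sB]) (use C in auto)
    show ?thesis
    proof (rule Lim_null_comparison)
      show "\<forall>\<^sub>F j in sequentially. norm (q ^ (2 * (j * (j + 1))) * A j) \<le> norm q ^ j * B"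
      proof (intro always_eventually allI)
        fix j
        have "norm q ^ (2 * (j * (j + 1))) \<le> norm q ^ j"
          using assms by (intro power_decreasing) auto
        then show "norm (q ^ (2 * (j * (j + 1))) * A j) \<le> norm q ^ j * B"
          unfolding norm_mult norm_power using AB by (intro mult_mono) auto
      qed
      show "(\<lambda>j. norm q ^ j * B) \<longlonglongrightarrow> 0"
        using assms by (intro tendsto_mult_left_zero LIMSEQ_power_zero) simp
    qed
  qed
  ultimately have "d \<longlonglongrightarrow> 0"
    unfolding d_def using tendsto_diff by fastforce
  then have "d 0 = 0"
    using d_const by (metis (no_types) LIMSEQ_const_iff LIMSEQ_unique ext)
  then have "d j = 0" using d_const by simp
  then show ?thesis
    using suminf_minus_initial_segment[OF r, of "2 * j"] by (simp add: d_def S_def A_def r_def)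
qed

section \<open>Both sides as double series with equal columns\<close>

lemma summable_power_times_power_square:
  fixes c r :: real
  assumes "c \<ge> 0" "0 \<le> r" "r < 1"
  shows "summable (\<lambda>j. c ^ j * r ^ j\<^sup>2)"
proof (rule summable_comparison_test_ev)
  have "(\<lambda>j. c * r ^ j) \<longlonglongrightarrow> 0"
    using assms by (intro tendsto_mult_right_zero LIMSEQ_power_zero) simp
  then have "\<forall>\<^sub>F j in sequentially. c * r ^ j < 1 / 2"
    by (rule order_tendstoD) simp
  then show "\<forall>\<^sub>F j in sequentially. norm (c ^ j * r ^ j\<^sup>2) \<le> (1 / 2) ^ j"
  proof eventually_elim
    case (elim j)
    have "c ^ j * r ^ j\<^sup>2 = (c * r ^ j) ^ j"
      by (simp add: power_mult_distrib power2_eq_square power_mult)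
    also have "\<dots> \<le> (1 / 2) ^ j"
      using elim assms by (intro power_mono) auto
    finally show ?case using assms by simp
  qed
qed (simp add: summable_geometric)

lemma jtp_coeff_reflect: "jtp_coeff q n (- 1 - j) = jtp_coeff q n j"
proof -
  have "(- 1 - j) * (- 1 - j + 1) = j * (j + 1)" "int n - (- 1 - j) = int n + 1 + j"
    "int n + 1 + (- 1 - j) = int n - j"
    by (simp_all add: algebra_simps)
  then show ?thesis by (simp only: jtp_coeff_def mult_ac)
qed

text \<open>The factor $(q^2;q^2)_{2n+1}$ in \<open>jtp_coeff\<close>, divided by $(-q)_{2n+1}$,
  leaves $(q)_{2n+1}$, and the reflection symmetry merges $j$ with $-1-j$.\<close>

lemma qpoch_summand_fold:
  assumes "q \<noteq> 0" "norm q < 1" "z \<noteq> 0"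
  shows "qpoch (- 1 / z) (q\<^sup>2) (n + 1) * qpoch (- z * q\<^sup>2) (q\<^sup>2) n / qpoch (- q) q (2 * n + 1) * q ^ n =
           (\<Sum>j\<le>n. (z powi int j + z powi (- 1 - int j)) * q ^ (j * (j + 1)) * bailey_term q n j)"
proof -
  define N where "N = qpoch (- q) q (2 * n + 1)"
  have N: "N \<noteq> 0" "qpoch (q\<^sup>2) (q\<^sup>2) (2 * n + 1) = qpoch q q (2 * n + 1) * N"
    using qpoch_self_nonzero[OF norm_power2_less_1[OF assms(2)], of "2 * n + 1"]
    unfolding qpoch_square_base N_def by auto
  have coeff: "jtp_coeff q n (int j) * q ^ n / N = q ^ (j * (j + 1)) * bailey_term q n j" if "j \<le> n" for j
  proof -
    have "int j * (int j + 1) = int (j * (j + 1))" by (simp add: algebra_simps)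
    then have "q powi (int j * (int j + 1)) = q ^ (j * (j + 1))" by (simp only: power_int_of_nat)
    moreover have "nat (int n - int j) = n - j" "nat (int n + 1 + int j) = n + j + 1"
      using that by auto
    ultimately show ?thesis using that N
      by (simp add: jtp_coeff_def bailey_term_def inv_qfac_def field_simps del: of_nat_add)
  qed
  have "qpoch (- 1 / z) (q\<^sup>2) (n + 1) * qpoch (- z * q\<^sup>2) (q\<^sup>2) n / N * q ^ n =
      (\<Sum>j\<le>n. z powi int j * jtp_coeff q n (int j) + z powi (- 1 - int j) * jtp_coeff q n (- 1 - int j)) / N * q ^ n"
    unfolding finite_jacobi_triple_product[OF assms] sum_int_symmetric_fold ..
  also have "\<dots> = (\<Sum>j\<le>n. (z powi int j + z powi (- 1 - int j)) * (jtp_coeff q n (int j) * q ^ n / N))"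
    unfolding jtp_coeff_reflect by (simp add: sum_distrib_left sum_divide_distrib algebra_simps)
  also have "\<dots> = (\<Sum>j\<le>n. (z powi int j + z powi (- 1 - int j)) * (q ^ (j * (j + 1)) * bailey_term q n j))"
    by (intro sum.cong refl) (simp add: coeff)
  finally show ?thesis by (simp add: N_def mult_ac)
qed

theorem theorem6p7:
  fixes q z :: complex
  assumes "0 < norm q" and "norm q < 1" and "z \<noteq> 0"
  defines "lhs \<equiv> (\<lambda>n::nat. qpoch (- 1 / z) (q ^ 2) (n + 1) * qpoch (- z * q ^ 2) (q ^ 2) n
                      / qpoch (- q) q (2 * n + 1) * q ^ n)"
    and "rhs \<equiv> (\<lambda>n::nat. q ^ (n * (n + 3) div 2) *
                      (\<Sum>j = - int (n div 2) - 1..int (n div 2). z powi j * q powi (- (j * (j + 1)))))"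
  shows "summable lhs \<and> summable rhs \<and> (\<Sum>n. lhs n) = (\<Sum>n. rhs n)"
proof -
  have q: "q \<noteq> 0" using assms by auto
  define w where "w = (\<lambda>j. z powi int j + z powi (- 1 - int j))"
  define r where "r = (\<lambda>n. q ^ (n * (n + 3) div 2))"
  \<comment> \<open>The rows of \<open>f\<close> and \<open>g\<close> sum to \<open>lhs n\<close>
    and \<open>rhs n\<close>; their columns will be shown to have equal sums.\<close>
  define f where "f = (\<lambda>n j. w j * q ^ (j * (j + 1)) * bailey_term q n j)"
  define g where "g = (\<lambda>n j. w j / q ^ (j * (j + 1)) * (if 2 * j \<le> n then r n else 0))"
  obtain C where C: "C > 0" "\<And>n j. norm (bailey_term q n j) \<le> norm q ^ n * C"
    using bailey_term_bounded[OF assms(2)] by metis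
  define x where "x = (\<lambda>n. norm q ^ n)"
  \<comment> \<open>The exponent $j^2$ is weak enough to majorise both arrays and strong enough to
    beat the powers of $z$ in \<open>w\<close>.\<close>
  define y where "y = (\<lambda>j. norm (w j) * norm q ^ j\<^sup>2)"
  have x: "summable x" "\<And>n. x n \<ge> 0"
    using assms by (auto simp: x_def)
  have y0: "y j \<ge> 0" for j
    by (simp add: y_def)
  have y: "summable y"
  proof (rule summable_comparison_test')
    show "summable (\<lambda>j. norm z ^ j * norm q ^ j\<^sup>2 + inverse (norm z) * (inverse (norm z) ^ j * norm q ^ j\<^sup>2))"
      using assms by (intro summable_add summable_mult summable_power_times_power_square) auto
    fix j :: nat
    have "norm (w j) \<le> norm z ^ j + inverse (norm z) * inverse (norm z) ^ j"
    proof -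
      have "z powi (- 1 - int j) = inverse z * inverse z ^ j"
        using assms by (simp add: power_int_diff power_int_minus field_simps)
      then have "w j = z ^ j + inverse z * inverse z ^ j" by (simp add: w_def)
      then show ?thesis
        using norm_triangle_ineq[of "z ^ j" "inverse z * inverse z ^ j"]
        by (simp only: norm_mult norm_power norm_inverse)
    qed
    then have "norm (w j) * norm q ^ j\<^sup>2 \<le> (norm z ^ j + inverse (norm z) * inverse (norm z) ^ j) * norm q ^ j\<^sup>2"
      by (rule mult_right_mono) simp
    then show "norm (y j) \<le> norm z ^ j * norm q ^ j\<^sup>2 + inverse (norm z) * (inverse (norm z) ^ j * norm q ^ j\<^sup>2)"
      by (simp add: y_def algebra_simps)
  qed
  have f_bound: "norm (f n j) \<le> x n * (C * y j)" for n j
  proof -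
    have "norm q ^ (j * (j + 1)) \<le> norm q ^ j\<^sup>2"
      using assms by (intro power_decreasing) (auto simp: power2_eq_square)
    then have "norm (w j) * norm q ^ (j * (j + 1)) * norm (bailey_term q n j)
        \<le> norm (w j) * norm q ^ j\<^sup>2 * (norm q ^ n * C)"
      using C by (intro mult_mono) auto
    then show ?thesis by (simp add: f_def x_def y_def norm_mult norm_power mult_ac)
  qed
  have g_bound: "norm (g n j) \<le> x n * y j" for n j
  proof (cases "2 * j \<le> n")
    case True
    have "2 * j * (2 * j) \<le> n * n"
      using True by (intro mult_le_mono)
    then have "2 * (n + j\<^sup>2 + j * (j + 1)) \<le> n * (n + 3)"
      using True by (simp add: algebra_simps power2_eq_square)
    then have "n + j\<^sup>2 + j * (j + 1) \<le> n * (n + 3) div 2"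
      by (simp only: less_eq_div_iff_mult_less_eq[of 2] zero_less_numeral mult.commute[of _ 2])
    then have "norm (r n) \<le> norm q ^ (n + j\<^sup>2 + j * (j + 1))"
      unfolding r_def norm_power using assms by (intro power_decreasing) auto
    then have "norm (r n) / norm q ^ (j * (j + 1)) \<le> norm q ^ n * norm q ^ j\<^sup>2"
      using assms by (simp add: power_add divide_le_eq)
    then have "norm (w j) * (norm (r n) / norm q ^ (j * (j + 1))) \<le> norm (w j) * (norm q ^ n * norm q ^ j\<^sup>2)"
      by (rule mult_left_mono) simp
    then show ?thesis using True
      by (simp add: g_def x_def y_def norm_mult norm_divide norm_power mult_ac)
  qed (simp add: g_def x_def y_def)
  have lhs: "lhs n = (\<Sum>j. f n j)" for n
  proof -
    have "lhs n = (\<Sum>j\<le>n. f n j)"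
      unfolding lhs_def f_def w_def by (rule qpoch_summand_fold[OF q assms(2,3)])
    also have "\<dots> = (\<Sum>j. f n j)"
      by (rule suminf_finite [symmetric]) (auto simp: f_def bailey_term_def)
    finally show ?thesis .
  qed
  have rhs: "rhs n = (\<Sum>j. g n j)" for n
  proof -
    have e: "q powi (- (int j * (int j + 1))) = 1 / q ^ (j * (j + 1))" for j
    proof -
      have "int j * (int j + 1) = int (j * (j + 1))" by (simp add: algebra_simps)
      then show ?thesis by (simp only: power_int_minus power_int_of_nat inverse_eq_divide)
    qed
    have e': "(- 1 - int j) * (- 1 - int j + 1) = int j * (int j + 1)" for j
      by (simp add: algebra_simps)
    have "rhs n = r n * (\<Sum>j\<le>n div 2. z powi int j * (1 / q ^ (j * (j + 1)))
        + z powi (- 1 - int j) * (1 / q ^ (j * (j + 1))))"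
      unfolding rhs_def sum_int_symmetric_fold e' e r_def ..
    also have "\<dots> = (\<Sum>j\<le>n div 2. w j / q ^ (j * (j + 1)) * r n)"
      unfolding sum_distrib_left by (intro sum.cong refl) (simp add: w_def add_divide_distrib distrib_right distrib_left mult.commute)
    also have "\<dots> = (\<Sum>j\<le>n div 2. g n j)"
      by (intro sum.cong) (auto simp: g_def)
    also have "\<dots> = (\<Sum>j. g n j)"
      by (rule suminf_finite [symmetric]) (auto simp: g_def)
    finally show ?thesis .
  qed
  have columns: "(\<Sum>n. f n j) = (\<Sum>n. g n j)" for j
  proof -
    define h where "h = (\<lambda>n. if 2 * j \<le> n then r n else 0)"
    have "(\<lambda>n. r (n + 2 * j)) sums (\<Sum>n. r (n + 2 * j))"
      using triangular_power_summable[OF assms(2)] unfolding r_def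
      by (intro summable_sums summable_ignore_initial_segment)
    then have "(\<lambda>n. h (n + 2 * j)) sums (\<Sum>n. r (n + 2 * j))"
      by (simp add: h_def)
    moreover have "(\<Sum>n<2 * j. h n) = 0"
      by (rule sum.neutral) (simp add: h_def)
    ultimately have h: "h sums (\<Sum>n. r (n + 2 * j))"
      using sums_iff_shift[of h "2 * j" "\<Sum>n. r (n + 2 * j)"] by simp
    have "(\<Sum>n. g n j) = w j / q ^ (j * (j + 1)) * (\<Sum>n. r (n + 2 * j))"
      using sums_unique[OF sums_mult[OF h, of "w j / q ^ (j * (j + 1))"]]
      unfolding g_def h_def by (rule sym)
    \<comment> \<open>The factor $q^{2j(j+1)}$ from \<open>bailey_suminf\<close> turns the weight
      $q^{-j(j+1)}$ of \<open>g\<close> into the weight $q^{j(j+1)}$ of \<open>f\<close>.\<close>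
    also have "\<dots> = w j / q ^ (j * (j + 1)) * (q ^ (2 * (j * (j + 1))) * (\<Sum>n. bailey_term q n j))"
      unfolding r_def bailey_suminf[OF assms(2)] ..
    also have "\<dots> = w j * q ^ (j * (j + 1)) * (\<Sum>n. bailey_term q n j)"
      unfolding mult_2 power_add using q by simp
    also have "\<dots> = (\<Sum>n. f n j)"
      unfolding f_def by (rule suminf_mult [symmetric, OF bailey_term_summable[OF assms(2)]])
    finally show ?thesis by simp
  qed
  have Cy: "summable (\<lambda>j. C * y j)" "\<And>j. C * y j \<ge> 0"
    using y y0 C by (auto intro: summable_mult)
  \<comment> \<open>Each instance supplies both the summability of the row sums and the passage to
    column sums.\<close>
  note F = suminf_swap_dominated[OF f_bound x Cy]
  note G = suminf_swap_dominated[OF g_bound x y y0]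
  have "lhs = (\<lambda>n. \<Sum>j. f n j)" "rhs = (\<lambda>n. \<Sum>j. g n j)"
    using lhs rhs by auto
  then show ?thesis
    using F G by (simp only: columns simp_thms)
qed
end
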